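(* Let $u$ be an odd prime and let $(x,y,z,n)$ be an exceptional solution of $[(u^2-4)n]^x+(4un)^y=[(u^2+4)n]^z$, with associated decomposition $u^2-4=u_1u_2$ (as defined in the context). If $u_1\equiv \pm 1 \pmod 8$, then $y$ is even.
   Context: Let $u$ be an odd prime. Consider the equation $[(u^2-4)n]^x+(4un)^y=[(u^2+4)n]^z$ in positive integers $x,y,z,n$. A solution $(x,y,z,n)$ is called exceptional if $n>1$ and $(x,y,z)\neq(2,2,2)$. It is known (from earlier work) that every exceptional solution satisfies $y>z>x$; moreover $\gcd(n,u^2+4)=1$, and $(u^2-4)^x=[(u^2+4)^z-(4u)^yn^{y-z}]\,n^{z-x}$ with the two factors on the right coprime. Hence there are unique coprime positive integers $u_1,u_2$ with $u_1u_2=u^2-4$, $(u^2+4)^z-(4u)^yn^{y-z}=u_1^x$ and $n^{z-x}=u_2^x$; this is the decomposition associated with the solution. *)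

theory Defs
  imports Complex_Main "HOL-Number_Theory.Number_Theory"
begin

definition is_solution :: "int \<Rightarrow> nat \<Rightarrow> nat \<Rightarrow> nat \<Rightarrow> int \<Rightarrow> bool" where
  "is_solution u x y z n \<longleftrightarrow>
     x > 0 \<and> y > 0 \<and> z > 0 \<and> n > 0 \<and>
     ((u^2 - 4) * n) ^ x + (4 * u * n) ^ y = ((u^2 + 4) * n) ^ z"

definition exceptional_solution :: "int \<Rightarrow> nat \<Rightarrow> nat \<Rightarrow> nat \<Rightarrow> int \<Rightarrow> bool" where
  "exceptional_solution u x y z n \<longleftrightarrow>
     is_solution u x y z n \<and> n > 1 \<and> (x, y, z) \<noteq> (2, 2, 2)"

text \<open>
  The exponents \<open>y - z\<close> and \<open>z - x\<close> are positive for every exceptional solution, but this is a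
  theorem about such solutions and is not made part of the definition.  The two power equations
  are therefore stated in the rationals with integer exponents, which rules out truncated
  subtraction without assuming \<open>x < z < y\<close>.
\<close>

definition associated_decomposition ::
    "int \<Rightarrow> nat \<Rightarrow> nat \<Rightarrow> nat \<Rightarrow> int \<Rightarrow> int \<Rightarrow> int \<Rightarrow> bool" where
  "associated_decomposition u x y z n u1 u2 \<longleftrightarrow>
     u1 > 0 \<and> u2 > 0 \<and> coprime u1 u2 \<and> u1 * u2 = u^2 - 4 \<and>
     (of_int ((u^2 + 4) ^ z) - of_int ((4 * u) ^ y) * of_int n powi (int y - int z) :: rat)
       = of_int (u1 ^ x) \<and>
     (of_int n powi (int z - int x) :: rat) = of_int (u2 ^ x)"

end

theory Submission
  imports Defs
begin

text \<open>
  Write \<open>w = u\<^sup>2 + 4\<close>, so that \<open>w \<equiv> 5\<close> modulo 8, and suppose that \<open>y\<close> is odd.  The equation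
  \<open>w^z - u1^x = (4u)^y n^(y - z)\<close> modulo 8 forces \<open>z\<close> to be even.  For divisors \<open>m\<close> of \<open>u\<^sup>2 - 4\<close>,
  quadratic reciprocity gives \<open>(m/w) = (w/m) = (8/m) = (2/m)\<close>, hence \<open>(u1/w) = 1\<close> and
  \<open>(u2/w) = -1\<close>; moreover \<open>(u/w) = (w/u) = (4/u) = 1\<close>.  Reading the equation modulo \<open>w\<close> with
  \<open>y - z\<close> odd gives \<open>(n/w) = 1\<close>.  Put \<open>d = gcd z x\<close>.  From \<open>n^(z - x) = u2^x\<close> one gets
  \<open>n^((z - x)/d) = u2^(x/d)\<close>, so \<open>x/d\<close> is even: \<open>x\<close> is divisible by a higher power of 2 than \<open>z\<close>.
  Therefore \<open>w^z - u1^x\<close> has 2-adic valuation exactly \<open>v + 2\<close>, where \<open>v\<close> is that of \<open>z\<close>.  But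
  \<open>2^(2y)\<close> divides this difference, and \<open>2^v \<le> z \<le> y\<close>: a contradiction.
\<close>

section \<open>Quadratic residue symbols\<close>

lemma Legendre_cong:
  assumes "[a = b] (mod p)"
  shows "Legendre a p = Legendre b p"
  using assms by (simp add: Legendre_def QuadRes_def cong_def)

lemma Legendre_values: "Legendre a p \<in> {-1, 0, 1}"
  by (simp add: Legendre_def)

lemma Legendre_eq_0_iff: "Legendre a p = 0 \<longleftrightarrow> p dvd a"
  by (simp add: Legendre_def cong_0_iff)

lemma Legendre_euler_int:
  fixes p :: int
  assumes "prime p" "p > 2"
  shows "[Legendre a p = a ^ ((nat p - 1) div 2)] (mod p)"
  using euler_criterion[of "nat p" a] assms by simp

text \<open>Two values in {-1, 0, 1} differ by at most 2, which is less than \<open>p\<close>. This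
  turns congruences from Euler's criterion into equalities of symbols.\<close>

lemma sign_values_cong_imp_eq:
  fixes p :: int
  assumes "p > 2" "[a = b] (mod p)" "a \<in> {-1, 0, 1}" "b \<in> {-1, 0, 1}"
  shows "a = b"
proof (rule ccontr)
  assume "a \<noteq> b"
  moreover have "p dvd \<bar>a - b\<bar>"
    using assms(2) by (simp add: cong_iff_dvd_diff)
  ultimately have "p \<le> \<bar>a - b\<bar>"
    by (intro zdvd_imp_le) auto
  then show False
    using assms by auto
qed

lemma Legendre_mult:
  fixes p :: int
  assumes "prime p" "p > 2"
  shows "Legendre (a * b) p = Legendre a p * Legendre b p"
proof (rule sign_values_cong_imp_eq[OF assms(2)])
  let ?k = "(nat p - 1) div 2"
  have "[Legendre (a * b) p = a ^ ?k * b ^ ?k] (mod p)"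
    using Legendre_euler_int[OF assms, of "a * b"] by (simp add: power_mult_distrib)
  also have "[a ^ ?k * b ^ ?k = Legendre a p * Legendre b p] (mod p)"
    by (intro cong_mult cong_sym[OF Legendre_euler_int] assms)
  finally show "[Legendre (a * b) p = Legendre a p * Legendre b p] (mod p)" .
  show "Legendre a p * Legendre b p \<in> {-1, 0, 1}"
    using Legendre_values[of a p] Legendre_values[of b p] by auto
qed (rule Legendre_values)

lemma Legendre_1:
  fixes p :: int
  assumes "p > 1"
  shows "Legendre 1 p = 1"
proof -
  have "QuadRes p 1"
    unfolding QuadRes_def by (rule exI[of _ 1]) simp
  moreover have "\<not> [1 = 0] (mod p)"
    using assms by (simp add: cong_0_iff)
  ultimately show ?thesis
    by (simp add: Legendre_def)
qed

lemma Legendre_minus_1: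
  fixes p :: int
  assumes "prime p" "p > 2"
  shows "Legendre (-1) p = (if p mod 4 = 1 then 1 else -1)"
proof -
  have "odd p"
    using assms prime_odd_int by blast
  have "(nat p - 1) div 2 = nat ((p - 1) div 2)"
    using assms(2) by linarith
  moreover have "even ((p - 1) div 2) \<longleftrightarrow> p mod 4 = 1"
    using \<open>odd p\<close> by presburger
  ultimately have "even ((nat p - 1) div 2) \<longleftrightarrow> p mod 4 = 1"
    using assms(2) by (simp add: even_nat_iff)
  then have "(-1) ^ ((nat p - 1) div 2) = (if p mod 4 = 1 then 1 else -1 :: int)"
    by auto
  with Legendre_euler_int[OF assms, of "-1"]
  have "[Legendre (-1) p = (if p mod 4 = 1 then 1 else -1)] (mod p)"
    by simp
  then show ?thesis
    by (rule sign_values_cong_imp_eq[OF assms(2) _ Legendre_values]) auto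
qed

text \<open>Gauss's lemma for the multiplier 2: the sign is the parity of the number of even
  integers in (h, 2h], where \<open>p = 2 * h + 1\<close>.\<close>

lemma Legendre_2:
  fixes p :: int
  assumes "prime p" "p > 2"
  shows "Legendre 2 p = (if p mod 8 \<in> {1, 7} then 1 else -1)"
proof -
  have "odd p"
    using assms prime_odd_int by blast
  define h where "h = (p - 1) div 2"
  have p: "p = 2 * h + 1"
    using \<open>odd p\<close> unfolding h_def by presburger
  interpret GAUSS "nat p" 2
  proof
    show "[2 \<noteq> 0] (mod int (nat p))"
      using assms(2) zdvd_imp_le[of p 2] by (auto simp: cong_0_iff)
    show "prime (nat p)"
      using assms(1) prime_int_nat_transfer by blast
  qed (use assms(2) in auto)
  have h: "(int (nat p) - 1) div 2 = h" "int (nat p) = 2 * h + 1"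
    using assms(2) p by linarith+
  \<comment> \<open>The doubles of 1, ..., \<open>h\<close> are below \<open>p\<close>, so the
    reduction modulo \<open>p\<close> in \<open>C\<close> changes nothing.\<close>
  have "C = (\<lambda>x. 2 * x) ` {0 <.. h}"
    unfolding A_def B_def C_def image_image h
    by (intro image_cong) auto
  moreover have "(\<lambda>x. 2 * x) ` {0 <.. h} \<inter> {h <..} = (\<lambda>x. 2 * x) ` {h div 2 <.. h}"
    using assms(2) p by (auto intro!: imageI)
  ultimately have "E = (\<lambda>x. 2 * x) ` {h div 2 <.. h}"
    unfolding E_def h by simp
  then have "card E = nat (h - h div 2)"
    by (simp add: card_image inj_on_def)
  moreover have "even (h - h div 2) \<longleftrightarrow> (2 * h + 1) mod 8 = 1 \<or> (2 * h + 1) mod 8 = 7"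
    by presburger
  ultimately have "even (card E) \<longleftrightarrow> p mod 8 \<in> {1, 7}"
    using assms(2) by (simp add: even_nat_iff p)
  then show ?thesis
    using gauss_lemma assms(2) by auto
qed

text \<open>
  The Jacobi symbol for odd positive \<open>m\<close>; the value at \<open>m = 0\<close> is 1, and the sign of \<open>m\<close> is
  ignored.
\<close>

definition jacobi :: "int \<Rightarrow> int \<Rightarrow> int" where
  "jacobi a m = (\<Prod>p\<in>#prime_factorization m. Legendre a p)"

lemma prime_factor_odd_gt_2:
  fixes p m :: int
  assumes "odd m" "p \<in># prime_factorization m"
  shows "prime p" "p > 2" "p dvd m"
proof -
  show *: "prime p" "p dvd m"
    using assms(2) by auto
  then have "p \<noteq> 2"
    using assms(1) by auto
  then show "p > 2"
    using prime_ge_2_int[OF *(1)] by simp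
qed

lemma jacobi_cong:
  assumes "[a = b] (mod m)"
  shows "jacobi a m = jacobi b m"
  unfolding jacobi_def
  by (intro arg_cong[where f = prod_mset] image_mset_cong Legendre_cong cong_dvd_modulus[OF assms]) auto

lemma jacobi_mult:
  assumes "odd m"
  shows "jacobi (a * b) m = jacobi a m * jacobi b m"
proof -
  have "jacobi (a * b) m = (\<Prod>p\<in>#prime_factorization m. Legendre a p * Legendre b p)"
    unfolding jacobi_def
    by (intro arg_cong[where f = prod_mset] image_mset_cong Legendre_mult prime_factor_odd_gt_2[OF assms])
  then show ?thesis
    by (simp add: jacobi_def prod_mset.distrib)
qed

lemma jacobi_1:
  assumes "odd m"
  shows "jacobi 1 m = 1"
proof -
  have "jacobi 1 m = (\<Prod>p\<in>#prime_factorization m. 1)"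
    unfolding jacobi_def
    by (intro arg_cong[where f = prod_mset] image_mset_cong Legendre_1)
      (use prime_factor_odd_gt_2[OF assms] in force)
  then show ?thesis
    by simp
qed

lemma jacobi_power:
  assumes "odd m"
  shows "jacobi (a ^ k) m = jacobi a m ^ k"
  by (induction k) (simp_all add: jacobi_1 jacobi_mult assms)

text \<open>Coprimality excludes the value 0 for every Legendre factor, so each factor is 1 or
  -1.\<close>

lemma jacobi_square:
  assumes "coprime a m"
  shows "jacobi a m ^ 2 = 1"
proof -
  have "Legendre a p ^ 2 = 1" if "p \<in># prime_factorization m" for p
  proof -
    have "\<not> p dvd a"
      using that assms coprime_common_divisor_int[of a m p] not_prime_unit[of p] by auto
    then show ?thesis
      using Legendre_values[of a p] Legendre_eq_0_iff[of a p] by auto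
  qed
  then have "\<forall>p\<in>#A. Legendre a p ^ 2 = 1 \<Longrightarrow> (\<Prod>p\<in>#A. Legendre a p) ^ 2 = 1" for A
    by (induction A) (auto simp: power_mult_distrib)
  with \<open>\<And>p. p \<in># prime_factorization m \<Longrightarrow> Legendre a p ^ 2 = 1\<close> show ?thesis
    by (simp add: jacobi_def)
qed

text \<open>All prime factors of \<open>m\<close> are 1 modulo 4, so each Legendre factor can be
  inverted without a sign; multiplicativity in the numerator then reassembles
  \<open>m\<close>.\<close>

lemma jacobi_reciprocity_prime:
  fixes q m :: int
  assumes m: "m > 0" "odd m" "\<And>p. prime p \<Longrightarrow> p dvd m \<Longrightarrow> p mod 4 = 1"
    and q: "prime q" "q > 2" "coprime q m"
  shows "jacobi q m = Legendre m q"
proof -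
  have recip: "Legendre q p = Legendre p q" if "p \<in># prime_factorization m" for p
  proof -
    note p = prime_factor_odd_gt_2[OF m(2) that]
    have "p mod 4 = 1"
      using m(3) p by blast
    have "p \<noteq> q"
      using p q coprime_common_divisor_int[of q m q] not_prime_unit[of q] by auto
    have "even ((q - 1) div 2 * ((p - 1) div 2))"
      using \<open>p mod 4 = 1\<close> by (simp add: even_mult_iff) presburger
    then have "even (nat ((q - 1) div 2 * ((p - 1) div 2)))"
      using p q by (simp add: even_nat_iff)
    then have "Legendre q p * Legendre p q = 1"
      using Quadratic_Reciprocity_int[of q p] p(1,2) q(1,2) \<open>p \<noteq> q\<close>
      by (metis neg_one_even_power prime_int_nat_transfer)
    then show ?thesis
      using Legendre_values[of q p] Legendre_values[of p q] by auto
  qed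
  have "(\<Prod>p\<in>#A. Legendre p q) = Legendre (prod_mset A) q" for A
    using q by (induction A) (simp_all add: Legendre_1 Legendre_mult)
  then have "(\<Prod>p\<in>#prime_factorization m. Legendre p q) = Legendre m q"
    using m(1) by (simp add: prod_mset_prime_factorization_int)
  moreover have "jacobi q m = (\<Prod>p\<in>#prime_factorization m. Legendre p q)"
    unfolding jacobi_def
    by (intro arg_cong[where f = prod_mset] image_mset_cong recip)
  ultimately show ?thesis
    by simp
qed

lemma jacobi_minus_1:
  assumes "odd m" "\<And>p. prime p \<Longrightarrow> p dvd m \<Longrightarrow> p mod 4 = 1"
  shows "jacobi (-1) m = 1"
proof -
  have "Legendre (-1) p = 1" if "p \<in># prime_factorization m" for p
    using prime_factor_odd_gt_2[OF assms(1) that] assms(2) by (simp add: Legendre_minus_1)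
  then have "jacobi (-1) m = (\<Prod>p\<in>#prime_factorization m. 1)"
    unfolding jacobi_def by (intro arg_cong[where f = prod_mset] image_mset_cong)
  then show ?thesis
    by simp
qed

section \<open>The modulus \<open>u\<^sup>2 + 4\<close>\<close>

text \<open>Modulo \<open>p\<close>, -1 is the square of \<open>u / 2\<close>, and -1 is a quadratic
  residue only for primes that are 1 modulo 4.\<close>

lemma prime_dvd_square_plus_4:
  fixes p u :: int
  assumes "odd u" "prime p" "p dvd u^2 + 4"
  shows "p mod 4 = 1"
proof -
  have "odd p"
  proof
    assume "even p"
    then have "even (u^2 + 4)"
      using assms(3) by (rule dvd_trans)
    then show False
      using assms(1) by simp
  qed
  then have "p > 2"
    using prime_ge_2_int[OF assms(2)] by (cases "p = 2") auto
  have "\<not> p dvd 2"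
    using \<open>p > 2\<close> zdvd_imp_le[of p 2] by auto
  then have "Legendre 2 p ^ 2 = 1"
    using Legendre_eq_0_iff[of 2 p] Legendre_values[of 2 p] by auto
  have "[u^2 = (-1) * 2^2] (mod p)"
    using assms(3) by (simp add: cong_iff_dvd_diff)
  then have "Legendre (u * u) p = Legendre ((-1) * (2 * 2)) p"
    by (intro Legendre_cong) (simp add: power2_eq_square)
  then have "Legendre u p ^ 2 = Legendre (-1) p * Legendre 2 p ^ 2"
    by (simp only: Legendre_mult[OF assms(2) \<open>p > 2\<close>] power2_eq_square)
  \<comment> \<open>A nonnegative sign suffices, since \<open>Legendre_minus_1\<close> leaves only
    the values 1 and -1.\<close>
  then have "Legendre (-1) p \<ge> 0"
    using \<open>Legendre 2 p ^ 2 = 1\<close> by (metis mult.right_neutral zero_le_power2)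
  then show ?thesis
    using Legendre_minus_1[OF assms(2) \<open>p > 2\<close>] by (auto split: if_splits)
qed

text \<open>The numbers \<open>u^2 - 4\<close> and \<open>u^2 + 4\<close> are odd and differ by
  8.\<close>

lemma coprime_square_plus_4:
  fixes u q :: int
  assumes "odd u" "q dvd u^2 - 4"
  shows "coprime q (u^2 + 4)"
proof -
  have "coprime (u^2 - 4) (2 ^ 3)"
    using assms(1) by (simp only: coprime_power_right_iff) simp
  moreover have "gcd (u^2 - 4) (u^2 + 4) = gcd (u^2 - 4) (2 ^ 3)"
    using gcd_add_mult[of "u^2 - 4" 1 "2 ^ 3"] by (simp add: add.commute)
  ultimately have "coprime (u^2 - 4) (u^2 + 4)"
    by (simp add: coprime_iff_gcd_eq_1)
  then show ?thesis
    by (rule coprime_divisors[OF assms(2) dvd_refl])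
qed

text \<open>Both sides are multiplicative in odd \<open>m\<close>, so induction on the prime factors
  reduces the claim to a prime \<open>q\<close>. There reciprocity and \<open>u^2 + 4\<close>
  \<equiv> 8 modulo \<open>q\<close> give the symbol of 8, which is that of 2.\<close>

lemma jacobi_square_plus_4:
  fixes u m :: int
  assumes "odd u" "m > 0" "m dvd u^2 - 4"
  shows "jacobi m (u^2 + 4) = (if m mod 8 \<in> {1, 7} then 1 else -1)"
  using assms(2,3)
proof (induction m rule: prime_divisors_induct)
  case (unit x)
  then show ?case
    using jacobi_1 assms(1) by simp
next
  case (factor q x)
  have odd_dvd: "odd k" if "k dvd u^2 - 4" for k
  proof
    assume "even k"
    then have "even (u^2 - 4)"
      using that by (rule dvd_trans)
    then show False
      using assms(1) by simp
  qed
  have q: "q > 0" "q > 2" "q dvd u^2 - 4"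
  proof -
    show "q > 0" "q dvd u^2 - 4"
      using factor by (auto intro: prime_gt_0_int dvd_mult_left)
    then have "odd q"
      using odd_dvd by blast
    then show "q > 2"
      using prime_ge_2_int[OF factor(1)] by (cases "q = 2") auto
  qed
  have x: "x > 0" "x dvd u^2 - 4"
    using factor q by (auto simp: zero_less_mult_iff intro: dvd_mult_right)
  have odd: "odd q" "odd x"
    using q x odd_dvd by blast+
  have cop: "coprime q (u^2 + 4)"
    by (rule coprime_square_plus_4[OF assms(1) q(3)])
  have "jacobi q (u^2 + 4) = Legendre (u^2 + 4) q"
    using assms(1) prime_dvd_square_plus_4 factor(1) q cop
    by (intro jacobi_reciprocity_prime) (auto simp: add_nonneg_pos)
  also have "\<dots> = Legendre (2 * (2 * 2)) q"
    by (rule Legendre_cong) (use q in \<open>simp add: cong_iff_dvd_diff\<close>)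
  also have "\<dots> = Legendre 2 q * (Legendre 2 q * Legendre 2 q)"
    by (simp only: Legendre_mult[OF factor(1) q(2)])
  also have "\<dots> = (if q mod 8 \<in> {1, 7} then 1 else -1)"
    using Legendre_2[OF factor(1) q(2)] by simp
  finally have "jacobi q (u^2 + 4) = (if q mod 8 \<in> {1, 7} then 1 else -1)" .
  \<comment> \<open>The classes 1 and 7 form a subgroup of index 2 in the units modulo 8.\<close>
  moreover have "(q * x) mod 8 \<in> {1, 7} \<longleftrightarrow> (q mod 8 \<in> {1, 7} \<longleftrightarrow> x mod 8 \<in> {1, 7})"
  proof -
    have "q mod 8 = 1 \<or> q mod 8 = 3 \<or> q mod 8 = 5 \<or> q mod 8 = 7"
      using odd(1) by presburger
    moreover have "x mod 8 = 1 \<or> x mod 8 = 3 \<or> x mod 8 = 5 \<or> x mod 8 = 7"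
      using odd(2) by presburger
    ultimately show ?thesis
      unfolding mod_mult_eq[of q 8 x, symmetric] by (elim disjE) simp_all
  qed
  moreover have "jacobi (q * x) (u^2 + 4) = jacobi q (u^2 + 4) * jacobi x (u^2 + 4)"
    using assms(1) by (intro jacobi_mult) simp
  ultimately show ?case
    using factor.IH[OF x] by simp
qed simp

section \<open>Powers of odd integers modulo powers of 2\<close>

text \<open>This fixes the 2-adic valuation of the power minus 1 at exactly \<open>v + 2\<close>: it
  is 2 for odd exponents, and each squaring raises it by one.\<close>

lemma power_mod_5_mod_8:
  fixes w :: int
  assumes "w mod 8 = 5" "odd k"
  shows "[w ^ (2 ^ v * k) = 1 + 2 ^ (v + 2)] (mod 2 ^ (v + 3))"
proof (induction v)
  case 0
  obtain j where k: "k = 2 * j + 1"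
    using assms(2) oddE by blast
  have w: "[w = 5] (mod 8)"
    using assms(1) by (simp add: cong_def)
  have "[w ^ (2 * j) = (5\<^sup>2) ^ j] (mod 8)"
    unfolding power_mult by (intro cong_pow w)
  also have "[(5\<^sup>2) ^ j = 1 ^ j] (mod (8 :: int))"
    by (intro cong_pow) (simp add: cong_def)
  finally have "[w ^ (2 * j) * w = 1 * 5] (mod 8)"
    using w by (intro cong_mult) auto
  then show ?case
    by (simp add: k mult.commute)
next
  case (Suc v)
  define t where "t = w ^ (2 ^ v * k)"
  obtain c where c: "t = 1 + 2 ^ (v + 2) + 2 ^ (v + 3) * c"
    using Suc unfolding t_def[symmetric]
    by (metis cong_iff_lin cong_sym mult.commute)
  define s :: int where "s = 2 ^ v"
  have t: "t = 1 + 4 * s + 8 * s * c"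
    unfolding c s_def by (simp add: power_add)
  have "t^2 - (1 + 8 * s) = 16 * s * (c + s * (1 + 2 * c)^2)"
    unfolding t by (simp add: power2_eq_square algebra_simps)
  then have "16 * s dvd t^2 - (1 + 8 * s)"
    by simp
  moreover have "w ^ (2 ^ Suc v * k) = t^2"
    unfolding t_def power_mult[symmetric] by (simp add: mult.commute mult.left_commute)
  ultimately show ?case
    unfolding cong_iff_dvd_diff s_def by (simp add: power_add mult.commute)
qed

text \<open>Induction from 8 dividing \<open>a^2 - 1\<close>: in t^2 - 1 = (t - 1)(t + 1) the even
  factor t + 1 contributes another 2.\<close>

lemma odd_power_mod_2_power:
  fixes a :: int
  assumes "odd a"
  shows "[a ^ (2 ^ Suc v * k) = 1] (mod 2 ^ (v + 3))"
proof -
  have "[a ^ (2 ^ Suc v) = 1] (mod 2 ^ (v + 3))"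
  proof (induction v)
    case 0
    have "8 dvd a^2 - 1"
    proof -
      obtain b where b: "a = 2 * b + 1"
        using assms oddE by blast
      have "even (b * (b + 1))"
        by simp
      then obtain c where "b * (b + 1) = 2 * c"
        by blast
      then have "a^2 - 1 = 8 * c"
        unfolding b by (simp add: power2_eq_square algebra_simps)
      then show ?thesis
        by simp
    qed
    then show ?case
      by (simp add: cong_iff_dvd_diff)
  next
    case (Suc v)
    define t where "t = a ^ (2 ^ Suc v)"
    have "2 ^ (v + 3) dvd t - 1"
      using Suc unfolding t_def cong_iff_dvd_diff .
    moreover have "2 dvd t + 1"
      using assms unfolding t_def by simp
    ultimately have "2 ^ (v + 3) * 2 dvd (t - 1) * (t + 1)"
      by (rule mult_dvd_mono)
    moreover have "a ^ (2 ^ Suc (Suc v)) = t * t"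
      unfolding t_def power_Suc[of 2 "Suc v"] mult_2 power_add ..
    then have "(t - 1) * (t + 1) = a ^ (2 ^ Suc (Suc v)) - 1"
      by (simp add: algebra_simps)
    ultimately show ?case
      unfolding cong_iff_dvd_diff by (simp add: power_add)
  qed
  then show ?thesis
    unfolding power_mult using cong_pow[of "a ^ 2 ^ Suc v" 1] by force
qed


section \<open>Parity of \<open>y\<close>\<close>

theorem theorem1p3:
  fixes u n u1 u2 :: int and x y z :: nat
  assumes "prime u" and "odd u"
    and "exceptional_solution u x y z n"
    and "associated_decomposition u x y z n u1 u2"
    and "[u1 = 1] (mod 8) \<or> [u1 = -1] (mod 8)"
  shows "even y"
proof (rule ccontr)
  assume "odd y"
  have pos: "x > 0" "n > 1"
    using assms(3) by (auto simp: exceptional_solution_def is_solution_def)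
  have dec: "u1 > 0" "u2 > 0" "u1 * u2 = u^2 - 4"
    and dec1: "(of_int ((u^2 + 4) ^ z) - of_int ((4 * u) ^ y) * of_int n powi (int y - int z) :: rat)
       = of_int (u1 ^ x)"
    and dec2: "(of_int n powi (int z - int x) :: rat) = of_int (u2 ^ x)"
    using assms(4) by (auto simp: associated_decomposition_def)

  \<comment> \<open>Residues modulo 8\<close>
  define w where "w = u^2 + 4"
  have "[u^2 = 1] (mod 8)"
    using odd_power_mod_2_power[OF assms(2), of 0 1] by simp
  then have usq_mod: "u^2 mod 8 = 1"
    by (simp add: cong_def)
  have w: "w > 0" "odd w" "w mod 8 = 5" "\<And>p. prime p \<Longrightarrow> p dvd w \<Longrightarrow> p mod 4 = 1"
  proof -
    show "w > 0" "odd w"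
      using assms(2) by (auto simp: w_def add_nonneg_pos)
    show "w mod 8 = 5"
      using mod_add_left_eq[of "u^2" 8 4] usq_mod by (simp add: w_def)
  qed (use prime_dvd_square_plus_4[OF assms(2)] in \<open>simp add: w_def\<close>)
  have u1_mod: "u1 mod 8 = 1 \<or> u1 mod 8 = 7"
    using assms(5) by (auto simp: cong_def)
  have u2_mod: "u2 mod 8 = 3 \<or> u2 mod 8 = 5"
  proof -
    \<comment> \<open>Here \<open>u1 * u2 = u^2 - 4\<close> \<equiv> 1 - 4 modulo 8.\<close>
    have "(u1 mod 8) * (u2 mod 8) mod 8 = 5"
      using mod_diff_left_eq[of "u^2" 8 4] usq_mod dec(3) by (simp add: mod_mult_eq)
    with u1_mod have "u2 mod 8 = 5 \<or> 7 * (u2 mod 8) mod 8 = 5"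
      by auto
    then show ?thesis
      by presburger
  qed
  then have "odd u2"
    by presburger
  have "u2 \<noteq> 1"
    using u2_mod by auto
  then have "u2 > 1"
    using dec(2) by simp
  have "odd u1"
    using u1_mod by presburger

  \<comment> \<open>Order of the exponents and coprimality of \<open>n\<close>\<close>
  have "z > x"
  proof (rule ccontr)
    assume "\<not> z > x"
    then have "int z - int x = - int (x - z)"
      by simp
    then have "(of_int n powi (int z - int x) :: rat) = inverse (of_int (n ^ (x - z)))"
      by (simp only: power_int_minus power_int_of_nat of_int_power)
    with dec2 have "inverse (of_int (n ^ (x - z)) :: rat) = of_int (u2 ^ x)"
      by simp
    moreover have "(of_int (n ^ (x - z)) :: rat) \<noteq> 0"
      using pos(2) by simp
    ultimately have "(of_int (u2 ^ x) * of_int (n ^ (x - z)) :: rat) = 1"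
      by (metis left_inverse)
    then have "(of_int (u2 ^ x * n ^ (x - z)) :: rat) = of_int 1"
      by simp
    then have "u2 ^ x dvd 1"
      by (metis dvd_triv_left of_int_eq_iff)
    then show False
      using \<open>u2 > 1\<close> pos(1) one_less_power[of u2 x] by simp
  qed
  then have "int z - int x = int (z - x)"
    by simp
  with dec2 have "(of_int (n ^ (z - x)) :: rat) = of_int (u2 ^ x)"
    by (simp only: power_int_of_nat of_int_power)
  then have n_eq: "n ^ (z - x) = u2 ^ x"
    by (simp only: of_int_eq_iff)
  \<comment> \<open>By \<open>n_eq\<close>, \<open>n\<close> and \<open>u2\<close> have the same
    prime divisors.\<close>
  have coprime_n: "coprime n m" if "coprime u2 m" for m
  proof -
    have "coprime (n ^ (z - x)) m"
      unfolding n_eq using that by simp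
    then show ?thesis
      using \<open>z > x\<close> by (simp add: coprime_power_left_iff)
  qed
  have "\<not> u dvd 2"
    using prime_ge_2_int[OF assms(1)] zdvd_imp_le[of u 2] assms(2) by (cases "u = 2") auto
  then have "\<not> u dvd 4"
    using prime_dvd_mult_iff[OF assms(1), of 2 2] by simp
  have "coprime n w"
    unfolding w_def using dec(3) by (intro coprime_n coprime_square_plus_4 assms(2)) (metis dvd_triv_right)
  have "coprime n (4 * u)"
  proof (rule coprime_n)
    have "\<not> u dvd u2"
    proof
      assume "u dvd u2"
      then have "u dvd u^2 - (u^2 - 4)"
        unfolding dec(3)[symmetric] by (intro dvd_diff) auto
      with \<open>\<not> u dvd 4\<close> show False
        by simp
    qed
    then have "coprime u2 u"
      using assms(1) by (simp add: prime_imp_coprime coprime_commute)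
    moreover have "coprime u2 (2 ^ 2)"
      using \<open>odd u2\<close> by (simp only: coprime_power_right_iff) simp
    ultimately show "coprime u2 (4 * u)"
      by simp
  qed

  have "y \<ge> z"
  proof (rule ccontr)
    assume "\<not> y \<ge> z"
    then have "int y - int z = - int (z - y)"
      by simp
    then have "(of_int n powi (int y - int z) :: rat) = inverse (of_int (n ^ (z - y)))"
      by (simp only: power_int_minus power_int_of_nat of_int_power)
    with dec1 have "of_int ((4 * u) ^ y) * inverse (of_int (n ^ (z - y))) =
        (of_int (w ^ z) - of_int (u1 ^ x) :: rat)"
      unfolding w_def by (simp only: algebra_simps)
    moreover have "(of_int (n ^ (z - y)) :: rat) \<noteq> 0"
      using pos(2) by simp
    ultimately have "(of_int ((4 * u) ^ y) :: rat) = (of_int (w ^ z) - of_int (u1 ^ x)) * of_int (n ^ (z - y))"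
      by (metis mult.assoc mult.right_neutral left_inverse)
    then have "(of_int ((4 * u) ^ y) :: rat) = of_int ((w ^ z - u1 ^ x) * n ^ (z - y))"
      by simp
    then have "(4 * u) ^ y = (w ^ z - u1 ^ x) * n ^ (z - y)"
      by (simp only: of_int_eq_iff)
    \<comment> \<open>If \<open>y < z\<close>, clearing the denominator makes \<open>n\<close>
      divide a power of \<open>4 * u\<close>, to which it is coprime.\<close>
    then have "n dvd (4 * u) ^ y"
      using \<open>\<not> y \<ge> z\<close> by (simp add: dvd_power)
    then have "is_unit n"
      using coprime_common_divisor[of n "(4 * u) ^ y" n] \<open>coprime n (4 * u)\<close> by simp
    then show False
      using pos(2) by simp
  qed
  then have "int y - int z = int (y - z)"
    by simp
  with dec1 have "(of_int (w ^ z - (4 * u) ^ y * n ^ (y - z)) :: rat) = of_int (u1 ^ x)"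
    by (simp only: power_int_of_nat of_int_power of_int_mult of_int_diff w_def)
  then have eq: "w ^ z - u1 ^ x = (4 * u) ^ y * n ^ (y - z)"
    unfolding of_int_eq_iff by simp
  have "y \<ge> 3"
    using \<open>y \<ge> z\<close> \<open>z > x\<close> pos(1) \<open>odd y\<close> by (cases "y = 2") auto
  have dvd: "2 ^ (2 * y) dvd w ^ z - u1 ^ x"
    unfolding eq power_mult_distrib power_mult by simp

  \<comment> \<open>Parity of \<open>z\<close>\<close>
  have "even z"
  proof (rule ccontr)
    assume "odd z"
    from power_mod_5_mod_8[OF w(3) this, of 0] have "[w ^ z = 5] (mod 8)"
      by simp
    moreover have "(2 :: int) ^ 3 dvd 2 ^ (2 * y)"
      using \<open>y \<ge> 3\<close> by (intro le_imp_power_dvd) simp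
    from dvd_trans[OF this dvd] have "[w ^ z = u1 ^ x] (mod 8)"
      by (simp add: cong_iff_dvd_diff)
    ultimately have "[u1 ^ x = 5] (mod 8)"
      using cong_sym cong_trans by blast
    moreover have "[u1 ^ x = 1] (mod 8) \<or> [u1 ^ x = -1] (mod 8)"
      using assms(5)
    proof
      assume "[u1 = 1] (mod 8)"
      from cong_pow[OF this, of x] show ?thesis
        by simp
    next
      assume "[u1 = -1] (mod 8)"
      from cong_pow[OF this, of x] show ?thesis
        by (cases "even x") auto
    qed
    ultimately show False
      by (auto simp: cong_def)
  qed

  \<comment> \<open>Jacobi symbols modulo \<open>w\<close>\<close>
  have "jacobi u1 w = 1"
    using jacobi_square_plus_4[OF assms(2) dec(1)] dec(3) u1_mod unfolding w_def
    by (metis dvd_triv_left insert_iff)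
  have "jacobi u2 w = -1"
  proof -
    have "u2 dvd u^2 - 4"
      using dec(3) by (metis dvd_triv_right)
    then show ?thesis
      using jacobi_square_plus_4[OF assms(2) dec(2)] u2_mod unfolding w_def by auto
  qed
  have "jacobi (4 * u) w = 1"
  proof -
    have "u > 2"
      using prime_ge_2_int[OF assms(1)] assms(2) by (cases "u = 2") auto
    have cong4: "[w = 2 * 2] (mod u)"
      by (simp add: cong_iff_dvd_diff w_def)
    have "\<not> u dvd w"
      using \<open>\<not> u dvd 4\<close> cong_dvd_iff[OF cong4] by simp
    then have "coprime u w"
      using assms(1) by (simp add: prime_imp_coprime)
    then have "jacobi u w = Legendre w u"
      using w assms(1) \<open>u > 2\<close> by (intro jacobi_reciprocity_prime)
    also have "\<dots> = Legendre (2 * 2) u"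
      by (rule Legendre_cong[OF cong4])
    also have "\<dots> = Legendre 2 u * Legendre 2 u"
      by (rule Legendre_mult[OF assms(1) \<open>u > 2\<close>])
    also have "\<dots> = 1"
      using Legendre_eq_0_iff[of 2 u] Legendre_values[of 2 u] \<open>\<not> u dvd 2\<close> by auto
    finally have "jacobi u w = 1" .
    moreover have "jacobi (2 ^ 2) w = 1"
      using jacobi_square[of 2 w] w(2) unfolding jacobi_power[OF w(2)] by simp
    ultimately show ?thesis
      using jacobi_mult[OF w(2), of "2 ^ 2" u] by simp
  qed
  have "jacobi n w = 1"
  proof -
    have "w dvd w ^ z"
      using \<open>z > x\<close> by (simp add: dvd_power)
    \<comment> \<open>All symbols here except that of \<open>n\<close> are known to be 1, including
      that of -1, and the odd exponent \<open>y - z\<close> then determines the symbol of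
      \<open>n\<close>.\<close>
    then have "[u1 ^ x = (-1) * ((4 * u) ^ y * n ^ (y - z))] (mod w)"
      unfolding eq[symmetric] by (simp add: cong_iff_dvd_diff)
    from jacobi_cong[OF this]
    have "jacobi u1 w ^ x = jacobi (-1) w * (jacobi (4 * u) w ^ y * jacobi n w ^ (y - z))"
      by (simp only: jacobi_mult[OF w(2)] jacobi_power[OF w(2)])
    then have "jacobi n w ^ (y - z) = 1"
      using \<open>jacobi u1 w = 1\<close> \<open>jacobi (4 * u) w = 1\<close> jacobi_minus_1[OF w(2,4)] by simp
    moreover have "odd (y - z)"
      using \<open>odd y\<close> \<open>even z\<close> \<open>y \<ge> z\<close> by simp
    moreover have "jacobi n w = 1 \<or> jacobi n w = -1"
      using jacobi_square[OF \<open>coprime n w\<close>] by (simp add: power2_eq_1_iff)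
    ultimately show ?thesis
      by auto
  qed

  \<comment> \<open>The 2-adic valuation of \<open>w ^ z - u1 ^ x\<close>\<close>
  define d where "d = gcd z x"
  have "d > 0"
    using pos(1) by (simp add: d_def)
  obtain a b where ab: "z = a * d" "x = b * d" "coprime a b"
    using gcd_coprime_exists[of z x] \<open>d > 0\<close> unfolding d_def by blast
  have "even b"
  proof (rule ccontr)
    assume "odd b"
    \<comment> \<open>Taking \<open>d\<close>-th roots of positive integers leaves the exponent
      \<open>b\<close> on \<open>u2\<close>; if it were odd, the two sides would have symbols 1 and
      -1.\<close>
    have "(n ^ (a - b)) ^ d = (u2 ^ b) ^ d"
      using n_eq unfolding ab(1,2) diff_mult_distrib[symmetric] power_mult .
    then have "n ^ (a - b) = u2 ^ b"
      by (rule power_eq_imp_eq_base) (use \<open>d > 0\<close> pos(2) dec(2) in simp_all)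
    then have "jacobi n w ^ (a - b) = jacobi u2 w ^ b"
      by (metis jacobi_power[OF w(2)])
    then show False
      using \<open>odd b\<close> \<open>jacobi n w = 1\<close> \<open>jacobi u2 w = -1\<close> by simp
  qed
  then have "odd a"
    using ab(3) coprime_common_divisor_nat[of a b 2] by auto
  obtain c where b: "b = 2 * c"
    using \<open>even b\<close> by blast
  obtain v k where d: "d = 2 ^ v * k" "odd k"
    using multiplicity_decompose'[of d 2] \<open>d > 0\<close> by (metis not_gr0 not_prime_unit two_is_prime_nat)
  \<comment> \<open>With \<open>a\<close> odd and \<open>b\<close> even, \<open>z\<close> is
    \<open>2 ^ v\<close> times an odd number while \<open>2 ^ Suc v\<close> divides
    \<open>x\<close>, so only \<open>w ^ z\<close> contributes the term
    \<open>2 ^ (v + 2)\<close>.\<close>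
  have "[w ^ (2 ^ v * (k * a)) = 1 + 2 ^ (v + 2)] (mod 2 ^ (v + 3))"
    using \<open>odd a\<close> d(2) by (intro power_mod_5_mod_8 w) simp
  then have "[w ^ z = 1 + 2 ^ (v + 2)] (mod 2 ^ (v + 3))"
    by (simp add: ab(1) d(1) mult_ac)
  moreover have "[u1 ^ (2 ^ Suc v * (k * c)) = 1] (mod 2 ^ (v + 3))"
    by (rule odd_power_mod_2_power[OF \<open>odd u1\<close>])
  then have "[u1 ^ x = 1] (mod 2 ^ (v + 3))"
    by (simp add: ab(2) d(1) b mult_ac)
  ultimately have "[w ^ z - u1 ^ x = 1 + 2 ^ (v + 2) - 1] (mod 2 ^ (v + 3))"
    by (rule cong_diff)
  then have "[w ^ z - u1 ^ x = 2 ^ (v + 2)] (mod 2 ^ (v + 3))"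
    by simp
  moreover have "\<not> (2 :: int) ^ (v + 3) dvd 2 ^ (v + 2)"
    using zdvd_imp_le[of "2 ^ (v + 3)" "2 ^ (v + 2)"] by (auto simp: power_add)
  ultimately have "\<not> (2 :: int) ^ (v + 3) dvd w ^ z - u1 ^ x"
    by (simp only: cong_dvd_iff not_False_eq_True)
  then have "2 * y < v + 3"
    using dvd_trans[OF le_imp_power_dvd dvd, of "v + 3"] by (meson not_le)
  moreover have "2 ^ v dvd z"
    by (simp add: ab(1) d(1))
  then have "2 ^ v \<le> z"
    by (rule dvd_imp_le) (use \<open>z > x\<close> in simp)
  \<comment> \<open>From v < \<open>2 ^ v\<close> \<le> \<open>z\<close> \<le> \<open>y\<close>;
    together with \<open>2 * y < v + 3\<close> this would force \<open>y\<close> below 3.\<close>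
  then have "v < y"
    using \<open>y \<ge> z\<close> less_exp[of v] by linarith
  ultimately show False
    using \<open>y \<ge> 3\<close> by linarith
qed

end
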